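(* Let $S$ be an $F$-inverse monoid. A congruence $\rho$ on $S$ is an $F$-congruence if and only if $\mathscr{K}(\rho)=\{[e]_\rho : e\in E(S)\}$ is an $F$-kernel normal system for $S$. Consequently, the map $\rho\mapsto \mathscr{K}(\rho)$ is a bijection between the $F$-congruences on $S$ and the $F$-kernel normal systems for $S$, with inverse $\mathscr{K}\mapsto \xi_{\mathscr{K}}$.
   Context: For an inverse semigroup $S$, $E(S)$ is its set of idempotents, $\leq$ is the natural partial order ($s\leq t$ iff $s=et$ for some $e\in E(S)$), and $\sigma$ is the minimum group congruence ($s\mathrel{\sigma}t$ iff $es=et$ for some $e\in E(S)$). $S$ is $F$-inverse if every $\sigma$-class has a maximum element with respect to $\leq$; such an $S$ is automatically a monoid with identity $1$, the maximum idempotent. For $a$ in an $F$-inverse monoid $S$, $a^{\mathfrak m}$ denotes the maximum element of the $\sigma$-class of $a$. A congruence on $S$ is an equivalence relation compatible with multiplication on both sides; $[a]_\rho$ is the $\rho$-class of $a$. An $F$-congruence on an $F$-inverse monoid $S$ is a congruence $\rho$ such that $a\mathrel{\rho}b$ implies $a^{\mathfrak m}\mathrel{\rho}b^{\mathfrak m}$ for all $a,b\in S$. A kernel normal system for an inverse semigroup $S$ is a family $\mathscr{K}$ of pairwise disjoint (nonempty) inverse subsemigroups of $S$ such that: (K1) $E(S)\subseteq\bigcup_{K\in\mathscr{K}}K$; (K2) for each $a\in S$ and $K\in\mathscr{K}$ there exists $L\in\mathscr{K}$ with $a^{-1}Ka\subseteq L$; (K3) if $a,ab,bb^{-1}\in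 K$ for some $K\in\mathscr{K}$ and $a,b\in S$, then $b\in K$. For a kernel normal system $\mathscr{K}$, the relation $\xi_{\mathscr{K}}$ on $S$ is defined by: $a\mathrel{\xi_{\mathscr{K}}}b$ iff there is $K\in\mathscr{K}$ with $aa^{-1},bb^{-1},ab^{-1}\in K$. A kernel normal system $\mathscr{K}$ for an $F$-inverse monoid $S$ is an $F$-kernel normal system if: whenever $a\in K$ for some $K\in\mathscr{K}$, then $a^{\mathfrak m}\in L$, where $L\in\mathscr{K}$ is the member with $1\in L$. *)

theory Defs
  imports Main
begin

text \<open>The semigroup \<open>S\<close> is the whole type \<open>'a\<close>, so \<open>S\<close> itself is \<open>UNIV\<close>.\<close>

definition (in semigroup_mult) idempotents :: "'a set"
  where "idempotents = {e. e * e = e}"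

definition (in semigroup_mult) natural_le :: "'a \<Rightarrow> 'a \<Rightarrow> bool"
  where "natural_le s t \<longleftrightarrow> (\<exists>e\<in>idempotents. s = e * t)"

definition (in semigroup_mult) min_group_congruence :: "'a rel"
  where "min_group_congruence = {(s, t). \<exists>e\<in>idempotents. e * s = e * t}"

definition (in semigroup_mult) is_maximum_of :: "'a \<Rightarrow> 'a set \<Rightarrow> bool"
  where "is_maximum_of m C \<longleftrightarrow> m \<in> C \<and> (\<forall>s\<in>C. natural_le s m)"

class inverse_semigroup = semigroup_mult +
  assumes ex1_inverse: "\<exists>!x. a * x * a = a \<and> x * a * x = x"

definition (in inverse_semigroup) inverse_of :: "'a \<Rightarrow> 'a"
  where "inverse_of a = (THE x. a * x * a = a \<and> x * a * x = x)"

class F_inverse_semigroup = inverse_semigroup +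
  assumes ex_maximum: "C \<in> UNIV // min_group_congruence \<Longrightarrow> \<exists>m. is_maximum_of m C"

definition (in F_inverse_semigroup) max_elt :: "'a \<Rightarrow> 'a"
  where "max_elt a = (THE m. is_maximum_of m (min_group_congruence `` {a}))"

context inverse_semigroup
begin

lemma inverse_of_props: "a * inverse_of a * a = a" "inverse_of a * a * inverse_of a = inverse_of a"
  using theI'[OF ex1_inverse[of a]] unfolding inverse_of_def by auto

lemma inverse_of_eqI: "a * x * a = a \<Longrightarrow> x * a * x = x \<Longrightarrow> inverse_of a = x"
  using ex1_inverse[of a] inverse_of_props[of a] by blast

lemma idempotents_mult_closed:
  assumes "e \<in> idempotents" "f \<in> idempotents"
  shows "e * f \<in> idempotents"
proof -
  have ee: "e * e = e" and ff: "f * f = f" using assms by (auto simp: idempotents_def)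
  have ee': "e * (e * z) = e * z" and ff': "f * (f * z) = f * z" for z
    using ee ff by (metis mult_assoc)+
  define x where "x = inverse_of (e * f)"
  have 1: "e * (f * (x * (e * f))) = e * f" and 2: "x * (e * (f * x)) = x"
    using inverse_of_props[of "e * f"] unfolding x_def[symmetric] by (simp_all add: mult_assoc)
  have h2': "x * (e * (f * (x * z))) = x * z" for z using 2 by (metis mult_assoc)
  have "inverse_of (e * f) = f * (x * e)"
    by (rule inverse_of_eqI) (simp_all add: mult_assoc ee' ff' 1 h2')
  then have x: "x = f * (x * e)" by (simp add: x_def)
  have "x * x = f * (x * (e * (f * (x * e))))" using arg_cong2[OF x x, of "(*)"] by (simp add: mult_assoc)
  also have "\<dots> = f * (x * e)" by (simp only: h2')
  also have "\<dots> = x" by (fact x[symmetric])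
  finally have xx: "x * x = x" .
  have "inverse_of x = x" by (rule inverse_of_eqI) (simp_all add: xx)
  moreover have "inverse_of x = e * f"
    by (rule inverse_of_eqI) (simp_all add: mult_assoc 1 2)
  ultimately show ?thesis using xx by (simp add: idempotents_def)
qed

lemma idempotents_commute:
  assumes "e \<in> idempotents" "f \<in> idempotents"
  shows "e * f = f * e"
proof -
  have ee: "e * e = e" and ff: "f * f = f" using assms by (auto simp: idempotents_def)
  have ee': "e * (e * z) = e * z" and ff': "f * (f * z) = f * z" for z
    using ee ff by (metis mult_assoc)+
  have a: "e * (f * (e * f)) = e * f" and b: "f * (e * (f * e)) = f * e"
    using idempotents_mult_closed[OF assms] idempotents_mult_closed[OF assms(2,1)]
    by (simp_all add: idempotents_def mult_assoc)
  have "inverse_of (e * f) = f * e"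
    by (rule inverse_of_eqI) (simp_all add: mult_assoc ee' ff' a b)
  moreover have "inverse_of (e * f) = e * f"
    by (rule inverse_of_eqI) (simp_all add: mult_assoc a)
  ultimately show ?thesis by simp
qed

lemma maximum_unique:
  assumes "is_maximum_of m C" "is_maximum_of n C"
  shows "m = n"
proof -
  obtain e f where e: "e \<in> idempotents" "m = e * n" and f: "f \<in> idempotents" "n = f * m"
    using assms unfolding is_maximum_of_def natural_le_def by blast
  have em: "e * m = m" using e by (metis (mono_tags) idempotents_def mem_Collect_eq mult_assoc)
  have "m = e * (f * m)" using e(2) f(2) by simp
  also have "\<dots> = f * (e * m)" using idempotents_commute[OF e(1) f(1)] by (metis mult_assoc)
  finally show ?thesis using em f(2) by simp
qed

end

context F_inverse_semigroup
begin

lemma max_elt_is_maximum: "is_maximum_of (max_elt a) (min_group_congruence `` {a})"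
proof -
  have "\<exists>m. is_maximum_of m (min_group_congruence `` {a})"
    by (intro ex_maximum quotientI) simp
  then have "\<exists>!m. is_maximum_of m (min_group_congruence `` {a})"
    using maximum_unique by blast
  then show ?thesis unfolding max_elt_def by (rule theI')
qed

text \<open>An \<open>F\<close>-inverse semigroup has an identity, so the class \<open>F_inverse_monoid\<close> below only
  gives that element the name \<open>1\<close>.\<close>

lemma ex_identity: "\<exists>u. (\<forall>x. u * x = x \<and> x * u = x) \<and> u \<in> idempotents \<and> (\<forall>e\<in>idempotents. natural_le e u)"
proof -
  define e0 :: 'a where "e0 = undefined * inverse_of undefined"
  define u where "u = max_elt e0"
  have inv_idem: "x * inverse_of x \<in> idempotents" "inverse_of x * x \<in> idempotents" for x
    using inverse_of_props[of x] by (simp_all add: idempotents_def) (metis mult_assoc)+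
  have e0: "e0 \<in> idempotents" using inv_idem by (simp add: e0_def)
  have "f \<in> min_group_congruence `` {e0}" if f: "f \<in> idempotents" for f
  proof -
    have "(e0 * f) * e0 = (e0 * f) * f"
      using idempotents_commute[OF e0 f] e0 f by (simp add: idempotents_def) (metis mult_assoc)
    then show ?thesis
      using idempotents_mult_closed[OF e0 f] unfolding min_group_congruence_def by blast
  qed
  then have le: "natural_le f u" if "f \<in> idempotents" for f
    using that max_elt_is_maximum[of e0] unfolding is_maximum_of_def u_def by blast
  obtain g where g: "g \<in> idempotents" "g * e0 = g * u"
    using max_elt_is_maximum[of e0] unfolding is_maximum_of_def min_group_congruence_def u_def
    by auto
  have fu: "f * u = f" if f: "f \<in> idempotents" for f
  proof -
    obtain h where h: "h \<in> idempotents" "f = h * u" using le[OF f] unfolding natural_le_def by blast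
    have "h * f = f" using h by (metis (mono_tags) idempotents_def mem_Collect_eq mult_assoc)
    then have "f * h = f" using idempotents_commute[OF f h(1)] by simp
    then show ?thesis using f h(2) by (metis (mono_tags) idempotents_def mem_Collect_eq mult_assoc)
  qed
  have right: "x * u = x" for x
    using fu[OF inv_idem(2)[of x]] inverse_of_props(1)[of x] by (metis mult_assoc)
  have uu: "u \<in> idempotents" using right by (simp add: idempotents_def)
  have left: "u * x = x" for x
    using idempotents_commute[OF uu inv_idem(1)[of x]] fu[OF inv_idem(1)[of x]]
      inverse_of_props(1)[of x] by (metis mult_assoc)
  show ?thesis using left right uu le by blast
qed

end

class F_inverse_monoid = F_inverse_semigroup + monoid_mult

definition congruence :: "('a::inverse_semigroup) rel \<Rightarrow> bool"
  where "congruence \<rho> \<longleftrightarrow> equiv UNIV \<rho> \<and>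
    (\<forall>a b c. (a, b) \<in> \<rho> \<longrightarrow> (c * a, c * b) \<in> \<rho> \<and> (a * c, b * c) \<in> \<rho>)"

definition F_congruence :: "('a::F_inverse_monoid) rel \<Rightarrow> bool"
  where "F_congruence \<rho> \<longleftrightarrow> congruence \<rho> \<and>
    (\<forall>a b. (a, b) \<in> \<rho> \<longrightarrow> (max_elt a, max_elt b) \<in> \<rho>)"

definition inverse_subsemigroup :: "('a::inverse_semigroup) set \<Rightarrow> bool"
  where "inverse_subsemigroup K \<longleftrightarrow> K \<noteq> {} \<and> (\<forall>a\<in>K. \<forall>b\<in>K. a * b \<in> K) \<and> (\<forall>a\<in>K. inverse_of a \<in> K)"

definition kernel_normal_system :: "('a::inverse_semigroup) set set \<Rightarrow> bool"
  where "kernel_normal_system \<K> \<longleftrightarrow>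
    pairwise disjnt \<K> \<and>
    (\<forall>K\<in>\<K>. inverse_subsemigroup K) \<and>
    idempotents \<subseteq> \<Union>\<K> \<and>
    (\<forall>a. \<forall>K\<in>\<K>. \<exists>L\<in>\<K>. (\<lambda>k. inverse_of a * k * a) ` K \<subseteq> L) \<and>
    (\<forall>a b. \<forall>K\<in>\<K>. a \<in> K \<and> a * b \<in> K \<and> b * inverse_of b \<in> K \<longrightarrow> b \<in> K)"

definition F_kernel_normal_system :: "('a::F_inverse_monoid) set set \<Rightarrow> bool"
  where "F_kernel_normal_system \<K> \<longleftrightarrow> kernel_normal_system \<K> \<and>
    (\<forall>K\<in>\<K>. \<forall>a\<in>K. \<exists>L\<in>\<K>. 1 \<in> L \<and> max_elt a \<in> L)"

definition idempotent_classes :: "('a::inverse_semigroup) rel \<Rightarrow> 'a set set"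
  where "idempotent_classes \<rho> = {\<rho> `` {e} | e. e \<in> idempotents}"

definition kns_rel :: "('a::inverse_semigroup) set set \<Rightarrow> 'a rel"
  where "kns_rel \<K> = {(a, b). \<exists>K\<in>\<K>.
    a * inverse_of a \<in> K \<and> b * inverse_of b \<in> K \<and> a * inverse_of b \<in> K}"

end

theory Submission
  imports Defs
begin

text \<open>
  Write \<open>a\<inverse>\<close> for \<open>inverse_of a\<close> (a superscript minus in the formulas),
  \<open>a\<^sup>m\<close> for \<open>max_elt a\<close>, \<open>\<sigma>\<close> for \<open>min_group_congruence\<close> and \<open>\<xi>\<close> for \<open>kns_rel \<K>\<close>.

  The argument has two layers. The first is Preston's theorem: on any inverse semigroup the
  congruences correspond to the kernel normal systems. A congruence \<open>\<rho>\<close> respects inversion,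
  and this lets \<open>a \<rho> b\<close> be recovered from the classes of the idempotents alone
  (\<open>kns_rel_idempotent_classes\<close>). Conversely, a kernel normal system \<open>\<K>\<close> can be viewed as the
  partial equivalence "lying in a common member of \<open>\<K>\<close>", which is stable under
  conjugation \<open>x \<mapsto> a\<inverse> x a\<close> (the conjugation axiom). The crux is that \<open>kns_rel \<K>\<close>, whose definition only mentions the range-side
  elements \<open>a a\<inverse>\<close>, \<open>b b\<inverse>\<close>, \<open>a b\<inverse>\<close>, is invariant under inversion
  (\<open>kns_rel_inverse\<close>). Left compatibility is just the conjugation axiom, so right compatibility follows by
  inverting, and transitivity and the identification of the idempotent classes with the members
  of \<open>\<K>\<close> follow from the cancellation axiom: \<open>a, a b, b b\<inverse> \<in> K\<close> imply \<open>b \<in> K\<close>.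

  The second layer is the maxima. The maximum of the \<open>\<sigma>\<close>-class of an idempotent is \<open>1\<close>, so
  the condition on an \<open>F\<close>-kernel normal system is the defining condition of an
  \<open>F\<close>-congruence restricted to pairs \<open>(a, e)\<close> with \<open>e\<close> idempotent. It already implies the
  full condition (\<open>max_elt_congruent\<close>): if \<open>a \<rho> b\<close> then \<open>a b\<inverse>\<close> is congruent to an
  idempotent, so \<open>c = (a b\<inverse>)\<^sup>m\<close> is congruent to \<open>1\<close>; moreover \<open>c b\<^sup>m\<close> lies in the
  \<open>\<sigma>\<close>-class of \<open>a\<close>, hence below \<open>a\<^sup>m\<close>. Thus \<open>b\<^sup>m\<close> is below \<open>a\<^sup>m\<close> modulo
  \<open>\<rho>\<close>, and by symmetry the two are congruent.
\<close>

section \<open>Calculating with inverses\<close>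

notation inverse_of ("_\<^sup>-" [1000] 999)

text \<open>Products are normalised to right-nested form below, so each cancellation law is also needed
  with a trailing factor \<open>z\<close>; the same applies to the commutation laws further on.\<close>

lemma mult_inverse_mult:
  fixes a :: "'a::inverse_semigroup"
  shows "a * (a\<^sup>- * a) = a" "a\<^sup>- * (a * a\<^sup>-) = a\<^sup>-"
    "a * (a\<^sup>- * (a * z)) = a * z" "a\<^sup>- * (a * (a\<^sup>- * z)) = a\<^sup>- * z"
  using inverse_of_props[of a] by (metis mult.assoc)+

lemma inverse_inverse [simp]:
  fixes a :: "'a::inverse_semigroup"
  shows "(a\<^sup>-)\<^sup>- = a"
  by (rule inverse_of_eqI) (rule inverse_of_props)+

lemma inverse_idempotent:
  fixes e :: "'a::inverse_semigroup"
  assumes "e \<in> idempotents"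
  shows "e\<^sup>- = e"
  using assms by (intro inverse_of_eqI) (simp_all add: idempotents_def)

lemma mult_inverse_idempotents:
  fixes a :: "'a::inverse_semigroup"
  shows "a * a\<^sup>- \<in> idempotents" "a\<^sup>- * a \<in> idempotents"
  by (simp_all add: idempotents_def mult.assoc mult_inverse_mult)

lemma mult_inverse_commute:
  fixes a b :: "'a::inverse_semigroup"
  shows "a\<^sup>- * (a * (b\<^sup>- * b)) = b\<^sup>- * (b * (a\<^sup>- * a))"
    "a\<^sup>- * (a * (b\<^sup>- * (b * z))) = b\<^sup>- * (b * (a\<^sup>- * (a * z)))"
    "a * (a\<^sup>- * (b\<^sup>- * (b * z))) = b\<^sup>- * (b * (a * (a\<^sup>- * z)))"
proof -
  have 1: "a\<^sup>- * a * (b\<^sup>- * b) = b\<^sup>- * b * (a\<^sup>- * a)"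
    and 2: "a * a\<^sup>- * (b\<^sup>- * b) = b\<^sup>- * b * (a * a\<^sup>-)"
    by (intro idempotents_commute mult_inverse_idempotents)+
  show "a\<^sup>- * (a * (b\<^sup>- * b)) = b\<^sup>- * (b * (a\<^sup>- * a))"
    using 1 by (simp only: mult.assoc)
  show "a\<^sup>- * (a * (b\<^sup>- * (b * z))) = b\<^sup>- * (b * (a\<^sup>- * (a * z)))"
    using arg_cong[OF 1, of "\<lambda>x. x * z"] unfolding mult.assoc .
  show "a * (a\<^sup>- * (b\<^sup>- * (b * z))) = b\<^sup>- * (b * (a * (a\<^sup>- * z)))"
    using arg_cong[OF 2, of "\<lambda>x. x * z"] unfolding mult.assoc .
qed

lemma inverse_mult:
  fixes a b :: "'a::inverse_semigroup"
  shows "(a * b)\<^sup>- = b\<^sup>- * a\<^sup>-"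
proof (rule inverse_of_eqI)
  have "a * b * (b\<^sup>- * a\<^sup>-) * (a * b) = a * (b * (b\<^sup>- * (a\<^sup>- * (a * b))))"
    by (simp add: mult.assoc)
  also have "\<dots> = a * (a\<^sup>- * (a * (b * (b\<^sup>- * b))))"
    by (simp only: mult_inverse_commute(3))
  finally show "a * b * (b\<^sup>- * a\<^sup>-) * (a * b) = a * b"
    by (simp add: mult_inverse_mult)
  have "b\<^sup>- * a\<^sup>- * (a * b) * (b\<^sup>- * a\<^sup>-) = b\<^sup>- * (a\<^sup>- * (a * (b * (b\<^sup>- * a\<^sup>-))))"
    by (simp add: mult.assoc)
  also have "\<dots> = b\<^sup>- * (b * (b\<^sup>- * (a\<^sup>- * (a * a\<^sup>-))))"
    by (simp only: mult_inverse_commute(3)[symmetric])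
  finally show "b\<^sup>- * a\<^sup>- * (a * b) * (b\<^sup>- * a\<^sup>-) = b\<^sup>- * a\<^sup>-"
    by (simp add: mult_inverse_mult)
qed

lemma conjugate_idempotent:
  fixes a :: "'a::inverse_semigroup"
  assumes "e \<in> idempotents"
  shows "a\<^sup>- * e * a \<in> idempotents"
proof -
  have "a\<^sup>- * e * a * (a\<^sup>- * e * a) = a\<^sup>- * (e * (a * a\<^sup>-)) * (e * a)"
    by (simp add: mult.assoc)
  also have "\<dots> = a\<^sup>- * ((a * a\<^sup>-) * e) * (e * a)"
    using idempotents_commute[OF assms mult_inverse_idempotents(1)[of a]] by simp
  also have "\<dots> = a\<^sup>- * (e * e) * a"
    by (simp add: mult.assoc mult_inverse_mult)
  finally show ?thesis using assms by (simp add: idempotents_def)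
qed

section \<open>The kernel normal system of a congruence\<close>

lemma congruenceI:
  fixes \<rho> :: "('a::inverse_semigroup) rel"
  assumes "\<And>a. (a, a) \<in> \<rho>"
    and "\<And>a b. (a, b) \<in> \<rho> \<Longrightarrow> (b, a) \<in> \<rho>"
    and "\<And>a b c. (a, b) \<in> \<rho> \<Longrightarrow> (b, c) \<in> \<rho> \<Longrightarrow> (a, c) \<in> \<rho>"
    and "\<And>a b c. (a, b) \<in> \<rho> \<Longrightarrow> (c * a, c * b) \<in> \<rho>"
    and "\<And>a b c. (a, b) \<in> \<rho> \<Longrightarrow> (a * c, b * c) \<in> \<rho>"
  shows "congruence \<rho>"
  unfolding congruence_def
proof (intro conjI allI impI equivI reflI symI transI)
  show "\<rho> \<subseteq> UNIV \<times> UNIV" by simp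
qed (fact assms)+

context
  fixes \<rho> :: "('a::inverse_semigroup) rel"
  assumes \<rho>: "congruence \<rho>"
begin

lemma congruence_refl: "(a, a) \<in> \<rho>"
  using \<rho> by (auto simp: congruence_def equiv_def refl_on_def)

lemma congruence_sym: "(a, b) \<in> \<rho> \<Longrightarrow> (b, a) \<in> \<rho>"
  using \<rho> by (auto simp: congruence_def equiv_def sym_def)

lemma congruence_trans [trans]: "(a, b) \<in> \<rho> \<Longrightarrow> (b, c) \<in> \<rho> \<Longrightarrow> (a, c) \<in> \<rho>"
  using \<rho> unfolding congruence_def equiv_def by (blast dest: transD)

lemma congruence_left: "(a, b) \<in> \<rho> \<Longrightarrow> (c * a, c * b) \<in> \<rho>"
  using \<rho> by (auto simp: congruence_def)

lemma congruence_right: "(a, b) \<in> \<rho> \<Longrightarrow> (a * c, b * c) \<in> \<rho>"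
  using \<rho> by (auto simp: congruence_def)

lemma congruence_mult: "(a, b) \<in> \<rho> \<Longrightarrow> (c, d) \<in> \<rho> \<Longrightarrow> (a * c, b * d) \<in> \<rho>"
  by (rule congruence_trans[OF congruence_right congruence_left])

text \<open>Modulo \<open>\<rho>\<close>, each of the commuting idempotents \<open>a a\<inverse>\<close> and \<open>b b\<inverse>\<close> equals their
  product.\<close>

lemma congruence_mult_inverse:
  assumes "(a, b) \<in> \<rho>"
  shows "(a * a\<^sup>-, b * b\<^sup>-) \<in> \<rho>"
proof -
  have absorb: "(x * x\<^sup>- * (y * y\<^sup>-), y * y\<^sup>-) \<in> \<rho>" if xy: "(x, y) \<in> \<rho>" for x y
  proof -
    have "(x * x\<^sup>- * (y * y\<^sup>-), x * x\<^sup>- * (x * y\<^sup>-)) \<in> \<rho>"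
      by (rule congruence_left[OF congruence_right[OF congruence_sym[OF xy]]])
    also have "x * x\<^sup>- * (x * y\<^sup>-) = x * y\<^sup>-"
      by (simp add: mult.assoc mult_inverse_mult)
    also have "(x * y\<^sup>-, y * y\<^sup>-) \<in> \<rho>"
      by (rule congruence_right[OF xy])
    finally show ?thesis .
  qed
  have "b * b\<^sup>- * (a * a\<^sup>-) = a * a\<^sup>- * (b * b\<^sup>-)"
    by (intro idempotents_commute mult_inverse_idempotents)
  with absorb[OF congruence_sym[OF assms]] have "(a * a\<^sup>- * (b * b\<^sup>-), a * a\<^sup>-) \<in> \<rho>"
    by simp
  then show ?thesis
    by (rule congruence_trans[OF congruence_sym absorb[OF assms]])
qed

lemma congruence_inverse_mult:
  assumes "(a, b) \<in> \<rho>"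
  shows "(a\<^sup>- * a, b\<^sup>- * b) \<in> \<rho>"
proof -
  have absorb: "(y\<^sup>- * y * (x\<^sup>- * x), y\<^sup>- * y) \<in> \<rho>" if xy: "(x, y) \<in> \<rho>" for x y
  proof -
    have "(y\<^sup>- * y * (x\<^sup>- * x), y\<^sup>- * x * (x\<^sup>- * x)) \<in> \<rho>"
      by (rule congruence_right[OF congruence_left[OF congruence_sym[OF xy]]])
    also have "y\<^sup>- * x * (x\<^sup>- * x) = y\<^sup>- * x"
      by (simp add: mult.assoc mult_inverse_mult)
    also have "(y\<^sup>- * x, y\<^sup>- * y) \<in> \<rho>"
      by (rule congruence_left[OF xy])
    finally show ?thesis .
  qed
  have "b\<^sup>- * b * (a\<^sup>- * a) = a\<^sup>- * a * (b\<^sup>- * b)"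
    by (intro idempotents_commute mult_inverse_idempotents)
  with absorb[OF congruence_sym[OF assms]] have "(b\<^sup>- * b * (a\<^sup>- * a), a\<^sup>- * a) \<in> \<rho>"
    by simp
  then show ?thesis
    by (rule congruence_trans[OF congruence_sym absorb[OF assms]])
qed

text \<open>The chain is \<open>a\<inverse> = a\<inverse> a a\<inverse> \<rho> b\<inverse> b a\<inverse> \<rho> b\<inverse> a a\<inverse> \<rho> b\<inverse> b b\<inverse> = b\<inverse>\<close>.\<close>

lemma congruence_inverse:
  assumes "(a, b) \<in> \<rho>"
  shows "(a\<^sup>-, b\<^sup>-) \<in> \<rho>"
proof -
  have "a\<^sup>- = a\<^sup>- * a * a\<^sup>-" by (simp add: inverse_of_props)
  also have "(a\<^sup>- * a * a\<^sup>-, b\<^sup>- * b * a\<^sup>-) \<in> \<rho>"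
    by (rule congruence_right[OF congruence_inverse_mult[OF assms]])
  also have "(b\<^sup>- * b * a\<^sup>-, b\<^sup>- * a * a\<^sup>-) \<in> \<rho>"
    by (rule congruence_right[OF congruence_left[OF congruence_sym[OF assms]]])
  also have "b\<^sup>- * a * a\<^sup>- = b\<^sup>- * (a * a\<^sup>-)" by (simp add: mult.assoc)
  also have "(b\<^sup>- * (a * a\<^sup>-), b\<^sup>- * (b * b\<^sup>-)) \<in> \<rho>"
    by (rule congruence_left[OF congruence_mult_inverse[OF assms]])
  also have "b\<^sup>- * (b * b\<^sup>-) = b\<^sup>-" by (simp add: mult_inverse_mult)
  finally show ?thesis .
qed

lemma congruent_idempotent_mult:
  assumes "e \<in> idempotents" "(e, a) \<in> \<rho>" "(e, b) \<in> \<rho>"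
  shows "(e, a * b) \<in> \<rho>"
  using congruence_mult[OF assms(2,3)] assms(1) by (simp add: idempotents_def)

lemma kernel_normal_system_idempotent_classes: "kernel_normal_system (idempotent_classes \<rho>)"
  unfolding kernel_normal_system_def
proof (intro conjI ballI allI impI)
  show "pairwise disjnt (idempotent_classes \<rho>)"
  proof -
    have "idempotent_classes \<rho> \<subseteq> UNIV // \<rho>"
      by (auto simp: idempotent_classes_def quotient_def)
    then show ?thesis
      using \<rho> quotient_disj unfolding congruence_def pairwise_def disjnt_def by blast
  qed
next
  fix K assume "K \<in> idempotent_classes \<rho>"
  then obtain e where e: "e \<in> idempotents" "K = \<rho> `` {e}"
    by (auto simp: idempotent_classes_def)
  show "inverse_subsemigroup K"
    unfolding inverse_subsemigroup_def
  proof (intro conjI ballI)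
    show "K \<noteq> {}" using e congruence_refl by blast
    show "a * b \<in> K" if "a \<in> K" "b \<in> K" for a b
      using that e congruent_idempotent_mult by auto
    show "a\<^sup>- \<in> K" if "a \<in> K" for a
      using that e congruence_inverse[of e a] by (auto simp: inverse_idempotent)
  qed
next
  show "idempotents \<subseteq> \<Union> (idempotent_classes \<rho>)"
    unfolding idempotent_classes_def using congruence_refl by blast
next
  fix a K assume "K \<in> idempotent_classes \<rho>"
  then obtain e where e: "e \<in> idempotents" "K = \<rho> `` {e}"
    by (auto simp: idempotent_classes_def)
  show "\<exists>L\<in>idempotent_classes \<rho>. (\<lambda>k. a\<^sup>- * k * a) ` K \<subseteq> L"
  proof (rule bexI)
    show "(\<lambda>k. a\<^sup>- * k * a) ` K \<subseteq> \<rho> `` {a\<^sup>- * e * a}"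
      unfolding e(2) using congruence_right[OF congruence_left] by blast
    show "\<rho> `` {a\<^sup>- * e * a} \<in> idempotent_classes \<rho>"
      using conjugate_idempotent[OF e(1)] by (auto simp: idempotent_classes_def)
  qed
next
  fix a b K assume "K \<in> idempotent_classes \<rho>"
    and *: "a \<in> K \<and> a * b \<in> K \<and> b * b\<^sup>- \<in> K"
  then obtain e where e: "e \<in> idempotents" "K = \<rho> `` {e}"
    by (auto simp: idempotent_classes_def)
  then have a: "(e, a) \<in> \<rho>" and ab: "(e, a * b) \<in> \<rho>" and bb: "(e, b * b\<^sup>-) \<in> \<rho>"
    using * by auto
  note ab
  also have "(a * b, b * b\<^sup>- * b) \<in> \<rho>"
    by (rule congruence_right[OF congruence_trans[OF congruence_sym[OF a] bb]])
  also have "b * b\<^sup>- * b = b" by (simp add: inverse_of_props)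
  finally show "b \<in> K" using e by simp
qed

text \<open>From \<open>a a\<inverse>\<close>, \<open>b b\<inverse>\<close>, \<open>a b\<inverse>\<close> lying in one idempotent class, inversion also
  puts \<open>b a\<inverse>\<close> there. Then \<open>a \<rho> b a\<inverse> a\<close> and \<open>b \<rho> a b\<inverse> b\<close>, and multiplying the latter
  by \<open>a\<inverse> a\<close> shows the two right-hand sides to be congruent.\<close>

lemma kns_rel_idempotent_classes: "kns_rel (idempotent_classes \<rho>) = \<rho>"
proof (rule set_eqI, clarify, rule iffI)
  fix a b assume "(a, b) \<in> kns_rel (idempotent_classes \<rho>)"
  then obtain e where e: "e \<in> idempotents"
    and aa: "(e, a * a\<^sup>-) \<in> \<rho>" and bb: "(e, b * b\<^sup>-) \<in> \<rho>" and ab: "(e, a * b\<^sup>-) \<in> \<rho>"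
    by (auto simp: kns_rel_def idempotent_classes_def)
  have ba: "(e, b * a\<^sup>-) \<in> \<rho>"
    using congruence_inverse[OF ab] e by (simp add: inverse_idempotent inverse_mult)
  have a: "(a, b * a\<^sup>- * a) \<in> \<rho>"
    using congruence_right[OF congruence_trans[OF congruence_sym[OF aa] ba], of a]
    by (simp add: inverse_of_props)
  have b: "(b, a * b\<^sup>- * b) \<in> \<rho>"
    using congruence_right[OF congruence_trans[OF congruence_sym[OF bb] ab], of b]
    by (simp add: inverse_of_props)
  note a
  also have "(b * a\<^sup>- * a, a * b\<^sup>- * b) \<in> \<rho>"
    using congruence_right[OF b, of "a\<^sup>- * a"] mult_inverse_commute(1)[of b a]
    by (simp add: mult.assoc mult_inverse_mult)
  also note congruence_sym[OF b]
  finally show "(a, b) \<in> \<rho>" .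
next
  fix a b assume ab: "(a, b) \<in> \<rho>"
  have "\<rho> `` {b * b\<^sup>-} \<in> idempotent_classes \<rho>"
    using mult_inverse_idempotents(1)[of b] by (auto simp: idempotent_classes_def)
  moreover have "a * a\<^sup>- \<in> \<rho> `` {b * b\<^sup>-}" "b * b\<^sup>- \<in> \<rho> `` {b * b\<^sup>-}" "a * b\<^sup>- \<in> \<rho> `` {b * b\<^sup>-}"
    using congruence_mult_inverse[OF ab] congruence_right[OF ab] congruence_refl
    by (auto intro: congruence_sym)
  ultimately show "(a, b) \<in> kns_rel (idempotent_classes \<rho>)"
    unfolding kns_rel_def by blast
qed

end

section \<open>The congruence of a kernel normal system\<close>

context
  fixes \<K> :: "('a::inverse_semigroup) set set"
  assumes \<K>: "kernel_normal_system \<K>"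
begin

lemma member_unique:
  assumes "K \<in> \<K>" "L \<in> \<K>" "x \<in> K" "x \<in> L"
  shows "K = L"
proof (rule ccontr)
  assume "K \<noteq> L"
  with \<K> assms(1,2) have "disjnt K L"
    unfolding kernel_normal_system_def by (blast dest: pairwiseD)
  with assms(3,4) show False by (auto simp: disjnt_def)
qed

lemma member_subsemigroup: "K \<in> \<K> \<Longrightarrow> inverse_subsemigroup K"
  using \<K> by (simp add: kernel_normal_system_def)

lemma member_mult: "K \<in> \<K> \<Longrightarrow> x \<in> K \<Longrightarrow> y \<in> K \<Longrightarrow> x * y \<in> K"
  using member_subsemigroup[of K] by (simp add: inverse_subsemigroup_def)

lemma member_inverse: "K \<in> \<K> \<Longrightarrow> x \<in> K \<Longrightarrow> x\<^sup>- \<in> K"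
  using member_subsemigroup[of K] by (simp add: inverse_subsemigroup_def)

lemma member_of_idempotent:
  assumes "e \<in> idempotents"
  obtains K where "K \<in> \<K>" "e \<in> K"
proof -
  have "idempotents \<subseteq> \<Union>\<K>" using \<K> by (simp add: kernel_normal_system_def)
  then show ?thesis using assms that by blast
qed

lemma member_conjugate:
  assumes "K \<in> \<K>"
  shows "\<exists>L\<in>\<K>. \<forall>k\<in>K. a\<^sup>- * (k * a) \<in> L"
proof -
  obtain L where L: "L \<in> \<K>" "(\<lambda>k. a\<^sup>- * k * a) ` K \<subseteq> L"
    using \<K> assms unfolding kernel_normal_system_def by meson
  have "\<forall>k\<in>K. a\<^sup>- * (k * a) \<in> L"
    using L(2) unfolding image_subset_iff mult.assoc .
  then show ?thesis using L(1) by (rule rev_bexI[rotated])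
qed

lemma member_conjugate_inverse:
  assumes "K \<in> \<K>"
  shows "\<exists>L\<in>\<K>. \<forall>k\<in>K. a * (k * a\<^sup>-) \<in> L"
  using member_conjugate[OF assms, of "a\<^sup>-"] unfolding inverse_inverse .

lemma member_cancel_left:
  assumes "K \<in> \<K>" "x \<in> K" "x * y \<in> K" "y * y\<^sup>- \<in> K"
  shows "y \<in> K"
proof -
  have "\<forall>a b. \<forall>K\<in>\<K>. a \<in> K \<and> a * b \<in> K \<and> b * b\<^sup>- \<in> K \<longrightarrow> b \<in> K"
    using \<K> unfolding kernel_normal_system_def by (elim conjE)
  from this[rule_format, OF assms(1) conjI[OF assms(2) conjI[OF assms(3,4)]]]
  show ?thesis .
qed

text \<open>The left-right dual of the cancellation axiom is that axiom applied to inverses.\<close>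

lemma member_cancel_right:
  assumes K: "K \<in> \<K>" and x: "x \<in> K" and yx: "y * x \<in> K" and yy: "y\<^sup>- * y \<in> K"
  shows "y \<in> K"
proof -
  have "y\<^sup>- \<in> K"
  proof (rule member_cancel_left[OF K member_inverse[OF K x]])
    show "x\<^sup>- * y\<^sup>- \<in> K" using member_inverse[OF K yx] by (simp add: inverse_mult)
    show "y\<^sup>- * (y\<^sup>-)\<^sup>- \<in> K" using yy by simp
  qed
  then show ?thesis using member_inverse[OF K, of "y\<^sup>-"] by simp
qed

lemma kns_relI:
  "K \<in> \<K> \<Longrightarrow> a * a\<^sup>- \<in> K \<Longrightarrow> b * b\<^sup>- \<in> K \<Longrightarrow> a * b\<^sup>- \<in> K \<Longrightarrow> (a, b) \<in> kns_rel \<K>"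
  unfolding kns_rel_def by blast

text \<open>Let \<open>K\<close> witness \<open>a \<xi> b\<close>, and let \<open>L\<close>, \<open>M\<close> be the members containing \<open>a\<inverse> K a\<close> and
  \<open>b\<inverse> K b\<close>. Conjugating \<open>a b\<inverse> b a\<inverse>\<close> and \<open>b a\<inverse> a b\<inverse>\<close>, which lie in \<open>K\<close>, gives
  the same idempotent \<open>a\<inverse> a b\<inverse> b\<close>, so \<open>L = M\<close>; it contains \<open>a\<inverse> a\<close>, \<open>b\<inverse> b\<close>, and,
  since \<open>a\<inverse> a\<close> can be cancelled from \<open>a\<inverse> b a\<inverse> a\<close>, also \<open>a\<inverse> b\<close>.\<close>

lemma kns_rel_inverse:
  assumes "(a, b) \<in> kns_rel \<K>"
  shows "(a\<^sup>-, b\<^sup>-) \<in> kns_rel \<K>"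
proof -
  obtain K where K: "K \<in> \<K>" and aa: "a * a\<^sup>- \<in> K" and bb: "b * b\<^sup>- \<in> K" and ab: "a * b\<^sup>- \<in> K"
    using assms unfolding kns_rel_def by blast
  have ba: "b * a\<^sup>- \<in> K" using member_inverse[OF K ab] by (simp add: inverse_mult)
  obtain L where L: "L \<in> \<K>" "\<forall>k\<in>K. a\<^sup>- * (k * a) \<in> L"
    using member_conjugate[OF K, of a] by (elim bexE)
  obtain M where M: "M \<in> \<K>" "\<forall>k\<in>K. b\<^sup>- * (k * b) \<in> M"
    using member_conjugate[OF K, of b] by (elim bexE)
  have "a\<^sup>- * (a * (b\<^sup>- * b)) \<in> L"
    using bspec[OF L(2) member_mult[OF K ab ba]] mult_inverse_commute(1)[of b a]
    by (simp add: mult.assoc mult_inverse_mult)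
  moreover have "a\<^sup>- * (a * (b\<^sup>- * b)) \<in> M"
    using bspec[OF M(2) member_mult[OF K ba ab]] mult_inverse_commute(1)[of a b]
    by (simp add: mult.assoc mult_inverse_mult)
  ultimately have LM: "L = M" by (rule member_unique[OF L(1) M(1)])
  have La: "a\<^sup>- * a \<in> L" using bspec[OF L(2) aa] by (simp add: mult.assoc mult_inverse_mult)
  have Lb: "b\<^sup>- * b \<in> L" using bspec[OF M(2) bb] LM by (simp add: mult.assoc mult_inverse_mult)
  have "a\<^sup>- * b \<in> L"
  proof (rule member_cancel_right[OF L(1) La])
    show "a\<^sup>- * b * (a\<^sup>- * a) \<in> L" using bspec[OF L(2) ba] by (simp add: mult.assoc)
    show "(a\<^sup>- * b)\<^sup>- * (a\<^sup>- * b) \<in> L"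
      using bspec[OF M(2) aa] LM by (simp add: mult.assoc inverse_mult)
  qed
  then show ?thesis using L(1) La Lb unfolding kns_rel_def by auto
qed

lemma kns_rel_refl: "(a, a) \<in> kns_rel \<K>"
  unfolding kns_rel_def using member_of_idempotent[OF mult_inverse_idempotents(1)[of a]] by blast

lemma kns_rel_sym: "(a, b) \<in> kns_rel \<K> \<Longrightarrow> (b, a) \<in> kns_rel \<K>"
proof -
  assume "(a, b) \<in> kns_rel \<K>"
  then obtain K where K: "K \<in> \<K>" "a * a\<^sup>- \<in> K" "b * b\<^sup>- \<in> K" "a * b\<^sup>- \<in> K"
    unfolding kns_rel_def by blast
  have "b * a\<^sup>- \<in> K" using member_inverse[OF K(1,4)] by (simp add: inverse_mult)
  then show ?thesis by (rule kns_relI[OF K(1,3,2)])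
qed

text \<open>A single \<open>K\<close> witnesses both relations, because the witnesses share \<open>b b\<inverse>\<close>. In it
  \<open>(a b\<inverse> b a\<inverse>) (a c\<inverse>) = (a b\<inverse>) (b c\<inverse>)\<close>, so cancellation yields \<open>a c\<inverse> \<in> K\<close> once
  \<open>a c\<inverse> c a\<inverse> \<in> K\<close> is known. This last fact is where invariance under inversion enters:
  \<open>b\<inverse> b\<close> and \<open>c\<inverse> c\<close> lie in a common member, so their conjugates
  \<open>a b\<inverse> b a\<inverse> \<in> K\<close> and \<open>a c\<inverse> c a\<inverse>\<close> do too.\<close>

lemma kns_rel_trans:
  assumes ab: "(a, b) \<in> kns_rel \<K>" and bc: "(b, c) \<in> kns_rel \<K>"
  shows "(a, c) \<in> kns_rel \<K>"
proof -
  obtain K where K: "K \<in> \<K>" "a * a\<^sup>- \<in> K" "b * b\<^sup>- \<in> K" "a * b\<^sup>- \<in> K"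
    using ab unfolding kns_rel_def by blast
  obtain K' where K': "K' \<in> \<K>" "b * b\<^sup>- \<in> K'" "c * c\<^sup>- \<in> K'" "b * c\<^sup>- \<in> K'"
    using bc unfolding kns_rel_def by blast
  have cK: "c * c\<^sup>- \<in> K" "b * c\<^sup>- \<in> K"
    using K'(3,4) member_unique[OF K'(1) K(1) K'(2) K(3)] by simp_all
  obtain L where L: "L \<in> \<K>" "b\<^sup>- * b \<in> L" "c\<^sup>- * c \<in> L"
    using kns_rel_inverse[OF bc] unfolding kns_rel_def by auto
  have ba: "b * a\<^sup>- \<in> K" using member_inverse[OF K(1,4)] by (simp add: inverse_mult)
  have x: "a * (b\<^sup>- * (b * a\<^sup>-)) \<in> K"
    using member_mult[OF K(1,4) ba] by (simp add: mult.assoc)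
  obtain M where M: "M \<in> \<K>" "\<forall>k\<in>L. a * (k * a\<^sup>-) \<in> M"
    using member_conjugate_inverse[OF L(1), of a] by (elim bexE)
  have "a * (b\<^sup>- * (b * a\<^sup>-)) \<in> M" using bspec[OF M(2) L(2)] by (simp add: mult.assoc)
  then have "M = K" using x by (rule member_unique[OF M(1) K(1)])
  then have yy: "a * (c\<^sup>- * (c * a\<^sup>-)) \<in> K" using bspec[OF M(2) L(3)] by (simp add: mult.assoc)
  have "a * c\<^sup>- \<in> K"
  proof (rule member_cancel_left[OF K(1) x])
    have "a * (b\<^sup>- * (b * a\<^sup>-)) * (a * c\<^sup>-) = a * (b\<^sup>- * (b * (a\<^sup>- * (a * c\<^sup>-))))"
      by (simp add: mult.assoc)
    also have "\<dots> = a * (a\<^sup>- * (a * (b\<^sup>- * (b * c\<^sup>-))))"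
      by (simp only: mult_inverse_commute(2)[of b a])
    also have "\<dots> = a * b\<^sup>- * (b * c\<^sup>-)"
      by (simp add: mult.assoc mult_inverse_mult)
    finally show "a * (b\<^sup>- * (b * a\<^sup>-)) * (a * c\<^sup>-) \<in> K"
      using member_mult[OF K(1,4) cK(2)] by simp
    show "a * c\<^sup>- * (a * c\<^sup>-)\<^sup>- \<in> K"
      using yy by (simp add: mult.assoc inverse_mult)
  qed
  then show ?thesis by (rule kns_relI[OF K(1,2) cK(1)])
qed

lemma kns_rel_left:
  assumes "(a, b) \<in> kns_rel \<K>"
  shows "(c * a, c * b) \<in> kns_rel \<K>"
proof -
  obtain K where K: "K \<in> \<K>" "a * a\<^sup>- \<in> K" "b * b\<^sup>- \<in> K" "a * b\<^sup>- \<in> K"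
    using assms unfolding kns_rel_def by blast
  obtain L where L: "L \<in> \<K>" "\<forall>k\<in>K. c * (k * c\<^sup>-) \<in> L"
    using member_conjugate_inverse[OF K(1), of c] by (elim bexE)
  show ?thesis
  proof (rule kns_relI[OF L(1)])
    show "c * a * (c * a)\<^sup>- \<in> L" "c * b * (c * b)\<^sup>- \<in> L" "c * a * (c * b)\<^sup>- \<in> L"
      using bspec[OF L(2) K(2)] bspec[OF L(2) K(3)] bspec[OF L(2) K(4)]
      by (simp_all add: inverse_mult mult.assoc)
  qed
qed

lemma kns_rel_right:
  assumes "(a, b) \<in> kns_rel \<K>"
  shows "(a * c, b * c) \<in> kns_rel \<K>"
  using kns_rel_inverse[OF kns_rel_left[OF kns_rel_inverse[OF assms], of "c\<^sup>-"]]
  by (simp add: inverse_mult)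

lemma congruence_kns_rel: "congruence (kns_rel \<K>)"
  by (rule congruenceI)
    (fact kns_rel_refl kns_rel_sym kns_rel_trans kns_rel_left kns_rel_right)+

text \<open>If \<open>a\<close> is related to \<open>e\<close>, then \<open>a e\<close> lies in \<open>K\<close>, and by invariance under inversion so
  does \<open>a\<inverse> a\<close>; dual cancellation then removes \<open>e\<close>.\<close>

lemma kns_rel_class_idempotent:
  assumes K: "K \<in> \<K>" and e: "e \<in> idempotents" "e \<in> K"
  shows "kns_rel \<K> `` {e} = K"
proof (rule set_eqI, rule iffI)
  have ee: "e * e = e" and e': "e\<^sup>- = e"
    using e by (simp_all add: idempotents_def inverse_idempotent)
  {
    fix a assume a: "a \<in> K"
    have "e * e\<^sup>- \<in> K" "a * a\<^sup>- \<in> K" "e * a\<^sup>- \<in> K"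
      by (intro member_mult[OF K] member_inverse[OF K] a e(2))+
    then have "(e, a) \<in> kns_rel \<K>" by (rule kns_relI[OF K])
    then show "a \<in> kns_rel \<K> `` {e}" by simp
  next
    fix a assume "a \<in> kns_rel \<K> `` {e}"
    then have ae: "(a, e) \<in> kns_rel \<K>" by (auto intro: kns_rel_sym)
    obtain L where L: "L \<in> \<K>" "e \<in> L" "a * e \<in> L"
      using ae unfolding kns_rel_def by (auto simp: e' ee)
    obtain M where M: "M \<in> \<K>" "e \<in> M" "a\<^sup>- * a \<in> M"
      using kns_rel_inverse[OF ae] unfolding kns_rel_def by (auto simp: e' ee)
    have "L = K" "M = K"
      by (rule member_unique[OF L(1) K L(2) e(2)], rule member_unique[OF M(1) K M(2) e(2)])
    then show "a \<in> K" using member_cancel_right[OF K e(2)] L(3) M(3) by simp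
  }
qed

lemma idempotent_classes_kns_rel: "idempotent_classes (kns_rel \<K>) = \<K>"
proof (rule set_eqI, rule iffI)
  fix K assume "K \<in> idempotent_classes (kns_rel \<K>)"
  then obtain e where e: "e \<in> idempotents" "K = kns_rel \<K> `` {e}"
    by (auto simp: idempotent_classes_def)
  obtain L where L: "L \<in> \<K>" "e \<in> L" by (rule member_of_idempotent[OF e(1)])
  show "K \<in> \<K>" using L(1) e(2) kns_rel_class_idempotent[OF L(1) e(1) L(2)] by simp
next
  fix K assume K: "K \<in> \<K>"
  then obtain a where a: "a \<in> K"
    using member_subsemigroup[OF K] unfolding inverse_subsemigroup_def by blast
  have "a * a\<^sup>- \<in> K" by (intro member_mult[OF K] member_inverse[OF K] a)
  then have "K = kns_rel \<K> `` {a * a\<^sup>-}"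
    using kns_rel_class_idempotent[OF K mult_inverse_idempotents(1)] by simp
  then show "K \<in> idempotent_classes (kns_rel \<K>)"
    using mult_inverse_idempotents(1) unfolding idempotent_classes_def by blast
qed

end

section \<open>Maximum elements\<close>

lemma min_group_congruenceI:
  fixes s t :: "'a::inverse_semigroup"
  shows "e \<in> idempotents \<Longrightarrow> e * s = e * t \<Longrightarrow> (s, t) \<in> min_group_congruence"
  unfolding min_group_congruence_def by blast

lemma min_group_congruence_idempotents:
  fixes e f :: "'a::inverse_semigroup"
  assumes "e \<in> idempotents" "f \<in> idempotents"
  shows "(e, f) \<in> min_group_congruence"
proof (rule min_group_congruenceI)
  show "e * f \<in> idempotents" using assms by (rule idempotents_mult_closed)
  have "e * f * e = f * e * e" using idempotents_commute[OF assms] by simp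
  also have "\<dots> = f * e" using assms(1) by (simp add: idempotents_def mult.assoc)
  also have "\<dots> = e * f" by (rule idempotents_commute[OF assms(2,1)])
  also have "\<dots> = e * f * f" using assms(2) by (simp add: idempotents_def mult.assoc)
  finally show "e * f * e = e * f * f" .
qed

lemma congruence_min_group_congruence:
  "congruence (min_group_congruence :: ('a::inverse_semigroup) rel)"
proof -
  have refl: "(a, a) \<in> min_group_congruence" for a :: 'a
    by (rule min_group_congruenceI[OF mult_inverse_idempotents(1)]) (rule refl)
  have sym: "(b, a) \<in> min_group_congruence" if ab: "(a, b) \<in> min_group_congruence" for a b :: 'a
  proof -
    obtain e where e: "e \<in> idempotents" "e * a = e * b"
      using ab unfolding min_group_congruence_def by blast
    show ?thesis by (rule min_group_congruenceI[OF e(1) e(2)[symmetric]])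
  qed
  have trans: "(a, c) \<in> min_group_congruence"
    if ab: "(a, b) \<in> min_group_congruence" and bc: "(b, c) \<in> min_group_congruence" for a b c :: 'a
  proof -
    obtain e f where e: "e \<in> idempotents" "e * a = e * b" and f: "f \<in> idempotents" "f * b = f * c"
      using ab bc unfolding min_group_congruence_def by blast
    have "f * e * a = e * f * b"
      using e idempotents_commute[OF e(1) f(1)] by (simp add: mult.assoc)
    also have "\<dots> = f * e * c"
      using f idempotents_commute[OF e(1) f(1)] by (metis mult.assoc)
    finally show ?thesis
      by (rule min_group_congruenceI[OF idempotents_mult_closed[OF f(1) e(1)]])
  qed
  have left: "(c * a, c * b) \<in> min_group_congruence" if ab: "(a, b) \<in> min_group_congruence" for a b c :: 'a
  proof -
    obtain e where e: "e \<in> idempotents" "e * a = e * b"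
      using ab unfolding min_group_congruence_def by blast
    \<comment> \<open>The conjugate \<open>c e c\<inverse>\<close> acts on the left of \<open>c\<close> as \<open>e\<close> acts on its right.\<close>
    have move: "c * e * c\<^sup>- * (c * x) = c * (e * x)" for x
    proof -
      have "c * e * c\<^sup>- * (c * x) = c * (e * (c\<^sup>- * c)) * x" by (simp add: mult.assoc)
      also have "\<dots> = c * (c\<^sup>- * c * e) * x"
        using idempotents_commute[OF e(1) mult_inverse_idempotents(2)[of c]] by simp
      finally show ?thesis by (simp add: mult.assoc mult_inverse_mult)
    qed
    show ?thesis
    proof (rule min_group_congruenceI)
      show "c * e * c\<^sup>- \<in> idempotents"
        using conjugate_idempotent[OF e(1), of "c\<^sup>-"] by simp
      show "c * e * c\<^sup>- * (c * a) = c * e * c\<^sup>- * (c * b)"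
        by (simp only: move e(2))
    qed
  qed
  have right: "(a * c, b * c) \<in> min_group_congruence" if ab: "(a, b) \<in> min_group_congruence" for a b c :: 'a
  proof -
    obtain e where e: "e \<in> idempotents" "e * a = e * b"
      using ab unfolding min_group_congruence_def by blast
    show ?thesis
      by (rule min_group_congruenceI[OF e(1)]) (simp only: mult.assoc[symmetric] e(2))
  qed
  show ?thesis
    by (rule congruenceI) (fact refl sym trans left right)+
qed

lemma max_elt_idempotent:
  fixes e :: "'a::F_inverse_monoid"
  assumes "e \<in> idempotents"
  shows "max_elt e = 1"
proof -
  have one: "(1::'a) \<in> idempotents" by (simp add: idempotents_def)
  obtain f where f: "f \<in> idempotents" "1 = f * max_elt e"
    using max_elt_is_maximum[of e] min_group_congruence_idempotents[OF assms one]
    unfolding is_maximum_of_def natural_le_def by blast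
  have "f = f * (f * max_elt e)" using f(2)[symmetric] by simp
  also have "\<dots> = f * max_elt e" using f(1) by (simp add: idempotents_def mult.assoc[symmetric])
  also have "\<dots> = 1" by (rule f(2)[symmetric])
  finally show ?thesis using f(2) by simp
qed

text \<open>Modulo \<open>\<sigma>\<close> idempotents are trivial, so \<open>(a b\<inverse>)\<^sup>m b\<^sup>m \<sigma> a b\<inverse> b \<sigma> a\<close>.\<close>

lemma max_elt_mult_le:
  fixes a b :: "'a::F_inverse_monoid"
  shows "natural_le (max_elt (a * b\<^sup>-) * max_elt b) (max_elt a)"
proof -
  note \<sigma> = congruence_min_group_congruence
  have max: "(x, max_elt x) \<in> min_group_congruence" for x :: 'a
    using max_elt_is_maximum[of x] unfolding is_maximum_of_def by blast
  have one: "(1::'a) \<in> idempotents" by (simp add: idempotents_def)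
  have "(a, a * b\<^sup>- * b) \<in> min_group_congruence"
    using congruence_left[OF \<sigma> min_group_congruence_idempotents[OF one mult_inverse_idempotents(2)],
        of a b]
    by (simp add: mult.assoc)
  then have "(a, max_elt (a * b\<^sup>-) * max_elt b) \<in> min_group_congruence"
    using congruence_mult[OF \<sigma> max max] by (rule congruence_trans[OF \<sigma>])
  then show ?thesis
    using max_elt_is_maximum[of a] unfolding is_maximum_of_def by blast
qed

text \<open>Since \<open>(a b\<inverse>)\<^sup>m \<rho> 1\<close>, the preceding inequality puts \<open>b\<^sup>m\<close> below \<open>a\<^sup>m\<close> in the
  natural order of \<open>S/\<rho>\<close>. Exchanging \<open>a\<close> and \<open>b\<close> gives the reverse, and antisymmetry of that
  order, carried out on representatives, gives the claim.\<close>

lemma max_elt_congruent: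
  fixes \<rho> :: "('a::F_inverse_monoid) rel"
  assumes \<rho>: "congruence \<rho>"
    and one: "\<And>a e. e \<in> idempotents \<Longrightarrow> (e, a) \<in> \<rho> \<Longrightarrow> (1, max_elt a) \<in> \<rho>"
    and ab: "(a, b) \<in> \<rho>"
  shows "(max_elt a, max_elt b) \<in> \<rho>"
proof -
  note sym = congruence_sym[OF \<rho>] and trans [trans] = congruence_trans[OF \<rho>]
    and left = congruence_left[OF \<rho>] and right = congruence_right[OF \<rho>]
  have below: "\<exists>e\<in>idempotents. (max_elt y, e * max_elt x) \<in> \<rho>" if xy: "(x, y) \<in> \<rho>" for x y
  proof -
    have "(1, max_elt (x * y\<^sup>-)) \<in> \<rho>"
      using one[OF mult_inverse_idempotents(1)] right[OF sym[OF xy]] .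
    from right[OF this, of "max_elt y"]
    have "(max_elt y, max_elt (x * y\<^sup>-) * max_elt y) \<in> \<rho>" by simp
    then show ?thesis using max_elt_mult_le[of x y] unfolding natural_le_def by metis
  qed
  define p where "p = max_elt a"
  define q where "q = max_elt b"
  obtain e where e: "e \<in> idempotents" "(q, e * p) \<in> \<rho>"
    using below[OF ab] unfolding p_def q_def by blast
  obtain f where f: "f \<in> idempotents" "(p, f * q) \<in> \<rho>"
    using below[OF sym[OF ab]] unfolding p_def q_def by blast
  have fp: "(f * p, p) \<in> \<rho>"
  proof -
    have "(f * p, f * (f * q)) \<in> \<rho>" by (rule left[OF f(2)])
    also have "f * (f * q) = f * q"
      using f(1) by (simp add: idempotents_def mult.assoc[symmetric])
    also have "(f * q, p) \<in> \<rho>" by (rule sym[OF f(2)])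
    finally show ?thesis .
  qed
  note f(2)
  also have "(f * q, f * (e * p)) \<in> \<rho>" by (rule left[OF e(2)])
  also have "f * (e * p) = e * (f * p)"
    using idempotents_commute[OF f(1) e(1)] by (simp add: mult.assoc[symmetric])
  also have "(e * (f * p), e * p) \<in> \<rho>" by (rule left[OF fp])
  also have "(e * p, q) \<in> \<rho>" by (rule sym[OF e(2)])
  finally show ?thesis unfolding p_def q_def .
qed

lemma F_congruence_iff:
  fixes \<rho> :: "('a::F_inverse_monoid) rel"
  assumes \<rho>: "congruence \<rho>"
  shows "F_congruence \<rho> \<longleftrightarrow> F_kernel_normal_system (idempotent_classes \<rho>)"
proof
  assume F: "F_congruence \<rho>"
  show "F_kernel_normal_system (idempotent_classes \<rho>)"
    unfolding F_kernel_normal_system_def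
  proof (intro conjI ballI)
    show "kernel_normal_system (idempotent_classes \<rho>)"
      by (rule kernel_normal_system_idempotent_classes[OF \<rho>])
  next
    fix K a assume "K \<in> idempotent_classes \<rho>" and a: "a \<in> K"
    then obtain e where e: "e \<in> idempotents" "K = \<rho> `` {e}"
      by (auto simp: idempotent_classes_def)
    then have "(e, a) \<in> \<rho>" using a by simp
    then have "(max_elt e, max_elt a) \<in> \<rho>" using F by (simp add: F_congruence_def)
    then have "max_elt a \<in> \<rho> `` {1}" using max_elt_idempotent[OF e(1)] by simp
    moreover have "1 \<in> \<rho> `` {1}" using congruence_refl[OF \<rho>] by simp
    moreover have "\<rho> `` {1} \<in> idempotent_classes \<rho>"
      by (auto simp: idempotent_classes_def idempotents_def)
    ultimately show "\<exists>L\<in>idempotent_classes \<rho>. 1 \<in> L \<and> max_elt a \<in> L" by blast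
  qed
next
  assume F: "F_kernel_normal_system (idempotent_classes \<rho>)"
  have one: "(1, max_elt a) \<in> \<rho>" if e: "e \<in> idempotents" "(e, a) \<in> \<rho>" for e a
  proof -
    have "\<rho> `` {e} \<in> idempotent_classes \<rho>" "a \<in> \<rho> `` {e}"
      using e by (auto simp: idempotent_classes_def)
    then have "\<exists>L\<in>idempotent_classes \<rho>. 1 \<in> L \<and> max_elt a \<in> L"
      using F by (simp add: F_kernel_normal_system_def)
    then obtain g where g: "(g, 1) \<in> \<rho>" "(g, max_elt a) \<in> \<rho>"
      by (auto simp: idempotent_classes_def)
    show ?thesis by (rule congruence_trans[OF \<rho> congruence_sym[OF \<rho> g(1)] g(2)])
  qed
  show "F_congruence \<rho>"
    unfolding F_congruence_def using \<rho> max_elt_congruent[OF \<rho> one] by simp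
qed

section \<open>The correspondence\<close>

lemma F_congruence_kns_rel:
  fixes \<K> :: "('a::F_inverse_monoid) set set"
  assumes "F_kernel_normal_system \<K>"
  shows "F_congruence (kns_rel \<K>)" "idempotent_classes (kns_rel \<K>) = \<K>"
proof -
  have K: "kernel_normal_system \<K>" using assms by (simp add: F_kernel_normal_system_def)
  show *: "idempotent_classes (kns_rel \<K>) = \<K>" by (rule idempotent_classes_kns_rel[OF K])
  show "F_congruence (kns_rel \<K>)"
    using F_congruence_iff[OF congruence_kns_rel[OF K]] assms by (simp add: *)
qed

theorem theorem3p7:
  shows
    "(\<forall>\<rho> :: ('a :: F_inverse_monoid) rel. congruence \<rho> \<longrightarrow>
        (F_congruence \<rho> \<longleftrightarrow> F_kernel_normal_system (idempotent_classes \<rho>))) \<and>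
     bij_betw idempotent_classes
       {\<rho> :: 'a rel. F_congruence \<rho>} {\<K>. F_kernel_normal_system \<K>} \<and>
     (\<forall>\<rho> :: 'a rel. F_congruence \<rho> \<longrightarrow> kns_rel (idempotent_classes \<rho>) = \<rho>) \<and>
     (\<forall>\<K> :: 'a set set. F_kernel_normal_system \<K> \<longrightarrow>
        F_congruence (kns_rel \<K>) \<and> idempotent_classes (kns_rel \<K>) = \<K>)"
proof (intro conjI allI impI)
  have cong: "congruence \<rho>" if "F_congruence \<rho>" for \<rho> :: "'a rel"
    using that by (simp add: F_congruence_def)
  show "F_congruence \<rho> \<longleftrightarrow> F_kernel_normal_system (idempotent_classes \<rho>)"
    if "congruence \<rho>" for \<rho> :: "'a rel"
    by (rule F_congruence_iff[OF that])
  show inverse: "kns_rel (idempotent_classes \<rho>) = \<rho>" if "F_congruence \<rho>" for \<rho> :: "'a rel"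
    by (rule kns_rel_idempotent_classes[OF cong[OF that]])
  show "F_congruence (kns_rel \<K>)" "idempotent_classes (kns_rel \<K>) = \<K>"
    if "F_kernel_normal_system \<K>" for \<K> :: "'a set set"
    by (rule F_congruence_kns_rel[OF that])+
  show "bij_betw idempotent_classes
      {\<rho> :: 'a rel. F_congruence \<rho>} {\<K>. F_kernel_normal_system \<K>}"
  proof (rule bij_betw_byWitness[where f' = kns_rel])
    show "\<forall>\<rho>\<in>{\<rho> :: 'a rel. F_congruence \<rho>}. kns_rel (idempotent_classes \<rho>) = \<rho>"
      using inverse by simp
    show "\<forall>\<K>\<in>{\<K> :: 'a set set. F_kernel_normal_system \<K>}. idempotent_classes (kns_rel \<K>) = \<K>"
      by (simp add: F_congruence_kns_rel(2))
    show "idempotent_classes ` {\<rho> :: 'a rel. F_congruence \<rho>} \<subseteq> {\<K>. F_kernel_normal_system \<K>}"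
      using F_congruence_iff[OF cong] by (simp add: image_subset_iff)
    show "kns_rel ` {\<K> :: 'a set set. F_kernel_normal_system \<K>} \<subseteq> {\<rho>. F_congruence \<rho>}"
      by (simp add: image_subset_iff F_congruence_kns_rel(1))
  qed
qed

end
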